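(* Let $f\in\mathbb{C}[h]$ and let $V$ be a simple $\mathcal{H}(f)$-module with $\dim V=n<\infty$. If $yV=V$ and $x^nV=0$, then $V\cong B'_{\mathcal{H}(f)}(\lambda,\dot z,a)$ for some $\dot z\in\mathbb{C}$, $a\in\mathbb{C}^*$ and $\lambda\in S_f$ with $|\lambda|=n$ such that $\lambda(i)+\dot z=0$ for some $i\in\mathbb{Z}$.
   Context: For $f(h)\in\mathbb{C}[h]$, $\mathcal{H}(f)$ is the unital associative $\mathbb{C}$-algebra generated by $x,y,h$ with relations $hx=xf(h)$, $yh=f(h)y$, $yx-xy=f(h)-h$. $S_f$ is the set of maps $\lambda:\mathbb{Z}\to\mathbb{C}$ with $f(\lambda(i))=\lambda(i+1)$ for all $i$; $|\lambda|$ is the nonnegative generator of the subgroup $\{m\in\mathbb{Z}\mid\lambda(i+m)=\lambda(i)\ \forall i\}$. For $\lambda\in S_f$ with $|\lambda|=m\neq0$, $\dot z\in\mathbb{C}$, $a\in\mathbb{C}^*$: $B'_{\mathcal{H}(f)}(\lambda,\dot z,a)$ is the quotient of $\mathbb{C}[t,t^{-1}]$ by $\mathbb{C}[t,t^{-1}](t^m-a)$, with $\mathcal{H}(f)$-action induced by $ht^i=\lambda(i)t^i$, $xt^i=(\lambda(i+1)+\dot z)t^{i+1}$, $yt^i=t^{i-1}$ ($i\in\mathbb{Z}$). *)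

theory Defs
  imports "Jordan_Normal_Form.Matrix" "HOL-Computational_Algebra.Polynomial"
begin

(* Evaluation of a polynomial at a square n x n matrix: f(A) = sum_i coeff f i * A^i *)
definition mat_poly :: "nat \<Rightarrow> complex poly \<Rightarrow> complex mat \<Rightarrow> complex mat" where
  "mat_poly n f A = foldr (\<lambda>i B. coeff f i \<cdot>\<^sub>m (A ^\<^sub>m i) + B) [0..<Suc (degree f)] (0\<^sub>m n n)"

(* An H(f)-module structure on V = C^n, given by the matrices of x, y, h:
   hx = x f(h),  yh = f(h) y,  yx - xy = f(h) - h *)
definition Hf_module :: "complex poly \<Rightarrow> nat \<Rightarrow> complex mat \<Rightarrow> complex mat \<Rightarrow> complex mat \<Rightarrow> bool" where
  "Hf_module f n X Y H \<longleftrightarrow>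
     X \<in> carrier_mat n n \<and> Y \<in> carrier_mat n n \<and> H \<in> carrier_mat n n \<and>
     H * X = X * mat_poly n f H \<and>
     Y * H = mat_poly n f H * Y \<and>
     Y * X - X * Y = mat_poly n f H - H"

(* subspace of C^n *)
definition subspace_vec :: "nat \<Rightarrow> complex vec set \<Rightarrow> bool" where
  "subspace_vec n W \<longleftrightarrow> W \<subseteq> carrier_vec n \<and> 0\<^sub>v n \<in> W \<and>
     (\<forall>v\<in>W. \<forall>w\<in>W. v + w \<in> W) \<and> (\<forall>c. \<forall>v\<in>W. c \<cdot>\<^sub>v v \<in> W)"

(* simple module: nonzero, and the only submodules are 0 and V *)
definition simple_Hf_module :: "complex poly \<Rightarrow> nat \<Rightarrow> complex mat \<Rightarrow> complex mat \<Rightarrow> complex mat \<Rightarrow> bool" where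
  "simple_Hf_module f n X Y H \<longleftrightarrow> Hf_module f n X Y H \<and> n \<noteq> 0 \<and>
     (\<forall>W. subspace_vec n W \<and> (\<forall>v\<in>W. X *\<^sub>v v \<in> W \<and> Y *\<^sub>v v \<in> W \<and> H *\<^sub>v v \<in> W)
          \<longrightarrow> W = {0\<^sub>v n} \<or> W = carrier_vec n)"

(* isomorphism of modules on C^n: simultaneous similarity *)
definition Hf_iso :: "nat \<Rightarrow> complex mat \<Rightarrow> complex mat \<Rightarrow> complex mat \<Rightarrow>
                      complex mat \<Rightarrow> complex mat \<Rightarrow> complex mat \<Rightarrow> bool" where
  "Hf_iso n X Y H X' Y' H' \<longleftrightarrow> (\<exists>P Q. P \<in> carrier_mat n n \<and> Q \<in> carrier_mat n n \<and>
      P * Q = 1\<^sub>m n \<and> Q * P = 1\<^sub>m n \<and>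
      P * X = X' * P \<and> P * Y = Y' * P \<and> P * H = H' * P)"

(* S_f *)
definition S_f :: "complex poly \<Rightarrow> (int \<Rightarrow> complex) set" where
  "S_f f = {lam. \<forall>i. poly f (lam i) = lam (i + 1)}"

(* |lam| = m : m is the nonnegative generator of the group of periods *)
definition seq_order :: "(int \<Rightarrow> complex) \<Rightarrow> int \<Rightarrow> bool" where
  "seq_order lam m \<longleftrightarrow> m \<ge> 0 \<and> {k. \<forall>i. lam (i + k) = lam i} = {j * m | j. True}"

(* B'(lam, z, a) with m = |lam| > 0, written in the basis t^0,...,t^(m-1) of
   C[t,t^-1]/(t^m - a).  Column j is the image of t^j.
   h t^j = lam j t^j;
   x t^j = (lam (j+1) + z) t^(j+1), where t^m = a t^0;
   y t^j = t^(j-1), where t^(-1) = a^-1 t^(m-1). *)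
definition B'_H :: "nat \<Rightarrow> (int \<Rightarrow> complex) \<Rightarrow> complex mat" where
  "B'_H m lam = mat m m (\<lambda>(i, j). if i = j then lam (int j) else 0)"

definition B'_X :: "nat \<Rightarrow> (int \<Rightarrow> complex) \<Rightarrow> complex \<Rightarrow> complex \<Rightarrow> complex mat" where
  "B'_X m lam z a = mat m m (\<lambda>(i, j). if i = (j + 1) mod m
       then (lam (int j + 1) + z) * (if j + 1 = m then a else 1) else 0)"

definition B'_Y :: "nat \<Rightarrow> complex \<Rightarrow> complex mat" where
  "B'_Y m a = mat m m (\<lambda>(i, j). if i = (j + m - 1) mod m
       then (if j = 0 then inverse a else 1) else 0)"

end

theory Submission
  imports Defs "Jordan_Normal_Form.Char_Poly"
    "HOL-Computational_Algebra.Fundamental_Theorem_Algebra"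
begin

text \<open>Since \<open>y\<close> is bijective, \<open>T = y\<^sup>-\<^sup>1\<close> exists. The Casimir element \<open>xy - h\<close> is central, hence a
  scalar \<open>c\<close> by Schur's lemma, so \<open>x = (h + c) T\<close>. The relation \<open>yh = f(h) y\<close> shows that \<open>T\<close> maps
  an \<open>h\<close>-eigenvector of weight \<open>\<alpha>\<close> to one of weight \<open>f(\<alpha>)\<close>; as \<open>h\<close> has only finitely many
  eigenvalues, some weight \<open>\<nu>\<close> is periodic under \<open>f\<close>, with minimal period \<open>m\<close> say, and \<open>T\<^sup>m\<close>
  preserves the \<open>\<nu>\<close>-weight space, where it has an eigenvector \<open>v\<close> with eigenvalue \<open>a \<noteq> 0\<close>.
  The vectors \<open>T\<^sup>k v\<close>, \<open>k < m\<close>, have the pairwise distinct weights \<open>f\<^sup>k(\<nu>)\<close>, so they are linearly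
  independent, and they span a submodule, hence all of \<open>V\<close>. Thus \<open>m = n\<close>, and in this basis
  \<open>x, y, h\<close> act exactly as on \<open>B'(\<lambda>, c, a)\<close> with \<open>\<lambda>(k) = f\<^sup>k(\<nu>)\<close>. Finally, \<open>x\<close> maps
  \<open>t\<^sup>k\<close> to \<open>(\<lambda>(k+1) + c) t\<^sup>k\<^sup>+\<^sup>1\<close> up to the factor \<open>a\<close>, so \<open>x\<^sup>n = 0\<close> forces some \<open>\<lambda>(i) + c = 0\<close>.\<close>

lemma mult_mat_vec_zero_vec [simp]: "A \<in> carrier_mat nr nc \<Longrightarrow> A *\<^sub>v 0\<^sub>v nc = 0\<^sub>v nr"
  by (intro eq_vecI) auto

lemma nonzero_vec_index: "v \<in> carrier_vec n \<Longrightarrow> v \<noteq> 0\<^sub>v n \<Longrightarrow> \<exists>i < n. v $ i \<noteq> 0"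
  by (metis carrier_vecD eq_vecI index_zero_vec)

lemma smult_vec_eq_zero_iff:
  fixes v :: "'a :: idom vec"
  assumes "v \<in> carrier_vec n" "v \<noteq> 0\<^sub>v n"
  shows "r \<cdot>\<^sub>v v = 0\<^sub>v n \<longleftrightarrow> r = 0"
proof
  assume rv: "r \<cdot>\<^sub>v v = 0\<^sub>v n"
  obtain i where "i < n" "v $ i \<noteq> 0"
    using nonzero_vec_index[OF assms] by blast
  with rv show "r = 0" by (metis index_smult_vec(1) index_zero_vec(1) carrier_vecD[OF assms(1)] mult_eq_0_iff)
qed (use assms in auto)

lemma minus_vec_eq_zero_iff:
  fixes u v :: "'a :: group_add vec"
  assumes "u \<in> carrier_vec n" "v \<in> carrier_vec n"
  shows "u - v = 0\<^sub>v n \<longleftrightarrow> u = v"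
proof
  assume "u - v = 0\<^sub>v n"
  then have "(u - v) $ i = 0" if "i < n" for i using that by simp
  then show "u = v" using assms by (intro eq_vecI) auto
qed (use assms in simp)

lemma minus_vec_eq_iff_eq_add:
  fixes u v w :: "'a :: ab_group_add vec"
  assumes "u \<in> carrier_vec n" "v \<in> carrier_vec n" "w \<in> carrier_vec n"
  shows "u - v = w \<longleftrightarrow> u = v + w"
proof
  assume "u - v = w"
  then have "u $ i = v $ i + w $ i" if "i < n" for i
    using that assms by (auto dest!: arg_cong[of _ _ "\<lambda>x. x $ i"] simp: algebra_simps)
  then show "u = v + w" using assms by (intro eq_vecI) auto
qed (use assms in \<open>auto intro!: eq_vecI\<close>)

lemma subspace_vec_carrier_vec: "subspace_vec n (carrier_vec n)"
  by (simp add: subspace_vec_def)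

definition cols_mat :: "nat \<Rightarrow> nat \<Rightarrow> (nat \<Rightarrow> 'a vec) \<Rightarrow> 'a mat" where
  "cols_mat n m w = mat n m (\<lambda>(i, k). w k $ i)"

lemma cols_mat_carrier [simp]: "cols_mat n m w \<in> carrier_mat n m"
  and dim_row_cols_mat [simp]: "dim_row (cols_mat n m w) = n"
  and dim_col_cols_mat [simp]: "dim_col (cols_mat n m w) = m"
  by (simp_all add: cols_mat_def)

lemma col_cols_mat: "k < m \<Longrightarrow> w k \<in> carrier_vec n \<Longrightarrow> col (cols_mat n m w) k = w k"
  by (intro eq_vecI) (auto simp: cols_mat_def)

lemma cols_mat_mult_unit_vec:
  fixes w :: "nat \<Rightarrow> 'a :: semiring_1 vec"
  assumes "k < m" "w k \<in> carrier_vec n"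
  shows "cols_mat n m w *\<^sub>v unit_vec m k = w k"
  using assms by (intro eq_vecI) (auto simp: cols_mat_def scalar_prod_def sum.delta' atLeast0LessThan if_distrib[of "\<lambda>x. _ * x"] cong: if_cong)

lemma mult_cols_mat:
  assumes A: "A \<in> carrier_mat n n'" and w: "\<And>k. k < m \<Longrightarrow> w k \<in> carrier_vec n'"
  shows "A * cols_mat n' m w = cols_mat n m (\<lambda>k. A *\<^sub>v w k)"
proof (rule eq_matI)
  fix i k assume "i < dim_row (cols_mat n m (\<lambda>k. A *\<^sub>v w k))" "k < dim_col (cols_mat n m (\<lambda>k. A *\<^sub>v w k))"
  then have "i < n" "k < m" by (auto simp: cols_mat_def)
  then show "(A * cols_mat n' m w) $$ (i, k) = cols_mat n m (\<lambda>k. A *\<^sub>v w k) $$ (i, k)"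
    using A col_cols_mat[of k m w n'] w by (simp add: cols_mat_def)
qed (use A in \<open>auto simp: cols_mat_def\<close>)

lemma mult_cols_mat_unit_vecs:
  fixes w :: "nat \<Rightarrow> 'a :: semiring_1 vec"
  assumes A: "A \<in> carrier_mat n n'" and w: "\<And>k. k < n \<Longrightarrow> w k \<in> carrier_vec n'"
    and Aw: "\<And>k. k < n \<Longrightarrow> A *\<^sub>v w k = unit_vec n k"
  shows "A * cols_mat n' n w = 1\<^sub>m n"
proof -
  have "A * cols_mat n' n w = cols_mat n n (\<lambda>k. A *\<^sub>v w k)" by (rule mult_cols_mat[OF A w])
  also have "\<dots> = 1\<^sub>m n" by (intro eq_matI) (auto simp: cols_mat_def Aw)
  finally show ?thesis .
qed

lemma mult_cols_mat_monomial:
  fixes A :: "'a :: comm_semiring_1 mat"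
  assumes A: "A \<in> carrier_mat n n" and w: "\<And>k. k < m \<Longrightarrow> w k \<in> carrier_vec n"
    and Aw: "\<And>k. k < m \<Longrightarrow> A *\<^sub>v w k = d k \<cdot>\<^sub>v w (\<sigma> k)" and \<sigma>: "\<And>k. k < m \<Longrightarrow> \<sigma> k < m"
  shows "A * cols_mat n m w = cols_mat n m w * mat m m (\<lambda>(i, k). if i = \<sigma> k then d k else 0)"
proof (rule eq_matI)
  fix r k assume "r < dim_row (cols_mat n m w * mat m m (\<lambda>(i, k). if i = \<sigma> k then d k else 0))"
    and "k < dim_col (cols_mat n m w * mat m m (\<lambda>(i, k). if i = \<sigma> k then d k else 0))"
  then have r: "r < n" and k: "k < m" by (auto simp: cols_mat_def)
  have "A * cols_mat n m w = cols_mat n m (\<lambda>k. A *\<^sub>v w k)" by (rule mult_cols_mat[OF A w])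
  then have "(A * cols_mat n m w) $$ (r, k) = d k * w (\<sigma> k) $ r"
    using r k w[OF \<sigma>[OF k]] by (simp add: cols_mat_def Aw)
  also have "\<dots> = (\<Sum>i<m. w i $ r * (if i = \<sigma> k then d k else 0))"
    using \<sigma>[OF k] by (simp add: if_distrib[of "\<lambda>x. _ * x"] sum.delta mult.commute cong: if_cong)
  also have "\<dots> = (cols_mat n m w * mat m m (\<lambda>(i, k). if i = \<sigma> k then d k else 0)) $$ (r, k)"
    using r k by (simp add: cols_mat_def scalar_prod_def atLeast0LessThan)
  finally show "(A * cols_mat n m w) $$ (r, k) = \<dots>" .
qed (use A in auto)

lemma surj_mat_right_inverse:
  fixes A :: "'a :: semiring_1 mat"
  assumes A: "A \<in> carrier_mat n m"
    and surj: "\<And>u. u \<in> carrier_vec n \<Longrightarrow> \<exists>v \<in> carrier_vec m. A *\<^sub>v v = u"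
  obtains B where "B \<in> carrier_mat m n" "A * B = 1\<^sub>m n"
proof -
  have "\<forall>k. \<exists>v. v \<in> carrier_vec m \<and> A *\<^sub>v v = unit_vec n k"
    using surj by (meson unit_vec_carrier)
  then obtain w where w: "\<And>k. w k \<in> carrier_vec m" "\<And>k. A *\<^sub>v w k = unit_vec n k" by metis
  show ?thesis by (rule that[of "cols_mat m n w"]) (auto intro: mult_cols_mat_unit_vecs[OF A] w)
qed

lemma wide_mat_kernel_nonzero:
  fixes A :: "'a :: idom mat"
  assumes A: "A \<in> carrier_mat n m" and nm: "n < m"
  obtains v where "v \<in> carrier_vec m" "v \<noteq> 0\<^sub>v m" "A *\<^sub>v v = 0\<^sub>v n"
proof -
  define B where "B = mat\<^sub>r m m (\<lambda>i. if i = n then 0\<^sub>v m else if i < n then row A i else 0\<^sub>v m)"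
  have "det B = 0" unfolding B_def by (rule det_row_0) (use nm A in auto)
  then obtain v where v: "v \<in> carrier_vec m" "v \<noteq> 0\<^sub>v m" "B *\<^sub>v v = 0\<^sub>v m"
    using det_0_iff_vec_prod_zero[of B m] by (auto simp: B_def)
  have "A *\<^sub>v v = 0\<^sub>v n"
  proof (rule eq_vecI)
    fix i assume "i < dim_vec (0\<^sub>v n :: 'a vec)"
    then have "i < n" by simp
    then show "(A *\<^sub>v v) $ i = 0\<^sub>v n $ i"
      using arg_cong[OF v(3), of "\<lambda>u. u $ i"] A nm by (simp add: B_def)
  qed (use A in simp)
  with v that show ?thesis by blast
qed

lemma square_mat_of_inj_surj:
  fixes P :: "'a :: field mat"
  assumes P: "P \<in> carrier_mat n m"
    and inj: "\<And>v. v \<in> carrier_vec m \<Longrightarrow> P *\<^sub>v v = 0\<^sub>v n \<Longrightarrow> v = 0\<^sub>v m"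
    and surj: "\<And>u. u \<in> carrier_vec n \<Longrightarrow> \<exists>v \<in> carrier_vec m. P *\<^sub>v v = u"
  shows "m = n" and "\<exists>Q \<in> carrier_mat n n. P * Q = 1\<^sub>m n \<and> Q * P = 1\<^sub>m n"
proof -
  obtain Q where Q: "Q \<in> carrier_mat m n" "P * Q = 1\<^sub>m n"
    using surj_mat_right_inverse[OF P surj] by blast
  have "\<not> n < m"
    using wide_mat_kernel_nonzero[OF P] inj by metis
  moreover have "\<not> m < n"
  proof
    assume "m < n"
    then obtain u where u: "u \<in> carrier_vec n" "u \<noteq> 0\<^sub>v n" "Q *\<^sub>v u = 0\<^sub>v m"
      using wide_mat_kernel_nonzero[OF Q(1)] by blast
    have "u = (P * Q) *\<^sub>v u" using Q(2) u(1) by simp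
    also have "\<dots> = 0\<^sub>v n" using P Q(1) u by simp
    finally show False using u(2) by blast
  qed
  ultimately show mn: "m = n" by simp
  show "\<exists>Q \<in> carrier_mat n n. P * Q = 1\<^sub>m n \<and> Q * P = 1\<^sub>m n"
    using Q mat_mult_left_right_inverse[of P n Q] P unfolding mn by blast
qed

lemma intertwine_inverse_mat:
  fixes A B P Q :: "'a :: semiring_1 mat"
  assumes P: "P \<in> carrier_mat n n" and Q: "Q \<in> carrier_mat n n"
    and A: "A \<in> carrier_mat n n" and B: "B \<in> carrier_mat n n"
    and PQ: "P * Q = 1\<^sub>m n" and QP: "Q * P = 1\<^sub>m n" and AP: "A * P = P * B"
  shows "Q * A = B * Q"
proof -
  have "Q * A = Q * A * (P * Q)" using Q A by (simp add: PQ)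
  also have "\<dots> = Q * (A * P) * Q" using P Q A by (simp add: assoc_mult_mat[of _ n n _ n _ n])
  also have "\<dots> = (Q * P) * B * Q" using P Q B by (simp add: AP assoc_mult_mat[of _ n n _ n _ n])
  also have "\<dots> = B * Q" using B Q by (simp add: QP)
  finally show ?thesis .
qed

lemma intertwine_pow_mat:
  fixes A B P :: "'a :: semiring_1 mat"
  assumes A: "A \<in> carrier_mat n n" and B: "B \<in> carrier_mat m m" and P: "P \<in> carrier_mat n m"
    and AP: "A * P = P * B"
  shows "A ^\<^sub>m k * P = P * B ^\<^sub>m k"
proof (induction k)
  case (Suc k)
  have "A ^\<^sub>m Suc k * P = A ^\<^sub>m k * (A * P)"
    using A P by (simp add: assoc_mult_mat[of _ n n _ n _ m])
  also have "\<dots> = (A ^\<^sub>m k * P) * B"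
    using A B P by (simp add: AP assoc_mult_mat[of _ n n _ m _ m])
  also have "\<dots> = P * B ^\<^sub>m Suc k"
    using B P by (simp add: Suc assoc_mult_mat[of _ n m _ m _ m])
  finally show ?case .
qed (use A B P in simp)

lemma intertwine_nilpotent:
  fixes A B P Q :: "'a :: semiring_1 mat"
  assumes A: "A \<in> carrier_mat n n" and B: "B \<in> carrier_mat n n"
    and P: "P \<in> carrier_mat n n" and Q: "Q \<in> carrier_mat n n"
    and QP: "Q * P = 1\<^sub>m n" and AP: "A * P = P * B" and nil: "A ^\<^sub>m k = 0\<^sub>m n n"
  shows "B ^\<^sub>m k = 0\<^sub>m n n"
proof -
  have "B ^\<^sub>m k = (Q * P) * B ^\<^sub>m k" using B by (simp add: QP)
  also have "\<dots> = Q * (A ^\<^sub>m k * P)"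
    using P Q B by (simp add: assoc_mult_mat[of _ n n _ n _ n] intertwine_pow_mat[OF A B P AP])
  also have "\<dots> = 0\<^sub>m n n" using P Q by (simp add: nil)
  finally show ?thesis .
qed

lemma intertwine_range_invariant:
  assumes M: "M \<in> carrier_mat n n" and P: "P \<in> carrier_mat n m" and B: "B \<in> carrier_mat m m"
    and MP: "M * P = P * B" and u: "u \<in> {P *\<^sub>v x | x. x \<in> carrier_vec m}"
  shows "M *\<^sub>v u \<in> {P *\<^sub>v x | x. x \<in> carrier_vec m}"
proof -
  obtain x where x: "x \<in> carrier_vec m" "u = P *\<^sub>v x" using u by blast
  have "M *\<^sub>v u = (P * B) *\<^sub>v x"
    using M P x by (simp add: MP[symmetric] assoc_mult_mat_vec[symmetric, of _ n n _ m] del: assoc_mult_mat_vec)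
  also have "\<dots> = P *\<^sub>v (B *\<^sub>v x)" using P B x by simp
  finally show ?thesis using B x(1) by auto
qed

lemma pow_mat_mult_vec:
  assumes A: "A \<in> carrier_mat n n" and v: "v \<in> carrier_vec n"
  shows "A ^\<^sub>m k *\<^sub>v v = ((*\<^sub>v) A ^^ k) v"
  using v
proof (induction k arbitrary: v)
  case (Suc k)
  have "A ^\<^sub>m Suc k *\<^sub>v v = A ^\<^sub>m k *\<^sub>v (A *\<^sub>v v)"
    using A Suc.prems by (simp add: assoc_mult_mat_vec[of _ n n _ n])
  then show ?case using Suc A by (simp add: funpow_Suc_right del: funpow.simps)
qed (use A in simp)

lemma subspace_vec_range_mat:
  assumes A: "A \<in> carrier_mat n m"
  shows "subspace_vec n {A *\<^sub>v v | v. v \<in> carrier_vec m}"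
  unfolding subspace_vec_def
proof (intro conjI ballI allI)
  show "0\<^sub>v n \<in> {A *\<^sub>v v | v. v \<in> carrier_vec m}"
    using A by (auto intro!: exI[of _ "0\<^sub>v m"])
  fix c u u' assume "u \<in> {A *\<^sub>v v | v. v \<in> carrier_vec m}" "u' \<in> {A *\<^sub>v v | v. v \<in> carrier_vec m}"
  then obtain v v' where "u = A *\<^sub>v v" "u' = A *\<^sub>v v'" "v \<in> carrier_vec m" "v' \<in> carrier_vec m" by blast
  then show "u + u' \<in> {A *\<^sub>v v | v. v \<in> carrier_vec m}"
    and "c \<cdot>\<^sub>v u \<in> {A *\<^sub>v v | v. v \<in> carrier_vec m}"
    using mult_add_distrib_mat_vec[OF A] mult_mat_vec[OF A]
    by (fastforce intro!: exI[of _ "v + v'"], fastforce intro!: exI[of _ "c \<cdot>\<^sub>v v"])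
qed (use A in auto)

lemma subspace_vec_kernel_mat:
  assumes A: "A \<in> carrier_mat n m"
  shows "subspace_vec m {v \<in> carrier_vec m. A *\<^sub>v v = 0\<^sub>v n}"
  unfolding subspace_vec_def using A mult_add_distrib_mat_vec[OF A] mult_mat_vec[OF A] by auto

lemma subspace_vec_eigenspace:
  "A \<in> carrier_mat n n \<Longrightarrow> subspace_vec n {v \<in> carrier_vec n. A *\<^sub>v v = r \<cdot>\<^sub>v v}"
  unfolding subspace_vec_def
  by (auto simp: mult_add_distrib_mat_vec mult_mat_vec smult_add_distrib_vec smult_smult_assoc mult.commute)

lemma index_mult_mat_vec_sum:
  assumes "A \<in> carrier_mat n m" "u \<in> carrier_vec m" "i < n"
  shows "(A *\<^sub>v u) $ i = (\<Sum>j<m. A $$ (i, j) * u $ j)"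
  using assms by (auto simp: scalar_prod_def atLeast0LessThan)

definition poly_act :: "complex mat \<Rightarrow> complex vec \<Rightarrow> complex poly \<Rightarrow> complex vec" where
  "poly_act S v p = foldr (\<lambda>a u. a \<cdot>\<^sub>v v + S *\<^sub>v u) (coeffs p) (0\<^sub>v (dim_vec v))"

context
  fixes S :: "complex mat" and v :: "complex vec" and n :: nat
  assumes S: "S \<in> carrier_mat n n" and v: "v \<in> carrier_vec n"
begin

lemma poly_act_carrier [simp]: "poly_act S v p \<in> carrier_vec n"
proof -
  have "foldr (\<lambda>a u. a \<cdot>\<^sub>v v + S *\<^sub>v u) as (0\<^sub>v (dim_vec v)) \<in> carrier_vec n" for as
    using S v by (induction as) auto
  then show ?thesis by (simp add: poly_act_def)
qed

lemma dim_poly_act [simp]: "dim_vec (poly_act S v p) = n"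
  by (rule carrier_vecD[OF poly_act_carrier])

lemma poly_act_0 [simp]: "poly_act S v 0 = 0\<^sub>v n"
  using v by (simp add: poly_act_def)

lemma poly_act_pCons: "poly_act S v (pCons a p) = a \<cdot>\<^sub>v v + S *\<^sub>v poly_act S v p"
proof (cases "a = 0 \<and> p = 0")
  case True
  then show ?thesis using S v by auto
next
  case False
  then have "coeffs (pCons a p) = a # coeffs p" by (auto simp: cCons_def)
  then show ?thesis by (simp add: poly_act_def)
qed

lemma poly_act_add: "poly_act S v (p + q) = poly_act S v p + poly_act S v q"
proof (induction p q rule: poly_induct2)
  case (pCons a p b q)
  have "poly_act S v (pCons a p + pCons b q) = (a + b) \<cdot>\<^sub>v v + S *\<^sub>v (poly_act S v p + poly_act S v q)"
    by (simp add: poly_act_pCons pCons)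
  also have "\<dots> = (a \<cdot>\<^sub>v v + S *\<^sub>v poly_act S v p) + (b \<cdot>\<^sub>v v + S *\<^sub>v poly_act S v q)"
    using S v by (simp add: mult_add_distrib_mat_vec[OF S]) (auto intro!: eq_vecI simp: ac_simps distrib_right)
  finally show ?case by (simp add: poly_act_pCons)
qed (use v in simp)

lemma poly_act_smult: "poly_act S v (smult r p) = r \<cdot>\<^sub>v poly_act S v p"
proof (induction p)
  case (pCons a p)
  have "poly_act S v (smult r (pCons a p)) = (r * a) \<cdot>\<^sub>v v + S *\<^sub>v (r \<cdot>\<^sub>v poly_act S v p)"
    by (simp add: poly_act_pCons pCons)
  also have "\<dots> = r \<cdot>\<^sub>v (a \<cdot>\<^sub>v v + S *\<^sub>v poly_act S v p)"
    using S v by (simp add: mult_mat_vec[OF S]) (auto intro!: eq_vecI simp: distrib_left)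
  finally show ?case by (simp add: poly_act_pCons)
qed (use v in \<open>auto intro!: eq_vecI\<close>)

lemma poly_act_linear_factor:
  "poly_act S v ([:-r, 1:] * q) = S *\<^sub>v poly_act S v q - r \<cdot>\<^sub>v poly_act S v q"
proof -
  have "[:-r, 1:] * q = smult (-r) q + pCons 0 q" by simp
  then have "poly_act S v ([:-r, 1:] * q) = (-r) \<cdot>\<^sub>v poly_act S v q + (0 \<cdot>\<^sub>v v + S *\<^sub>v poly_act S v q)"
    by (simp only: poly_act_add poly_act_smult poly_act_pCons)
  then show ?thesis using S v by (auto intro!: eq_vecI)
qed

lemma poly_act_in_subspace:
  assumes W: "subspace_vec n W" and inv: "\<And>u. u \<in> W \<Longrightarrow> S *\<^sub>v u \<in> W" and "v \<in> W"
  shows "poly_act S v p \<in> W"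
  by (induction p) (use W inv \<open>v \<in> W\<close> in \<open>auto simp: subspace_vec_def poly_act_pCons\<close>)

lemma poly_act_index:
  assumes "degree p \<le> N" and i: "i < n"
  shows "poly_act S v p $ i = (\<Sum>k<Suc N. coeff p k * ((*\<^sub>v) S ^^ k) v $ i)"
  using assms
proof (induction p arbitrary: N i)
  case (pCons a p)
  have Sk: "((*\<^sub>v) S ^^ k) v \<in> carrier_vec n" for k
    using S v by (induction k) auto
  have "(S *\<^sub>v poly_act S v p) $ i = (\<Sum>k<N. coeff p k * ((*\<^sub>v) S ^^ Suc k) v $ i)"
  proof (cases N)
    case 0
    with pCons.prems have "p = 0" by (auto split: if_splits)
    then show ?thesis using 0 S v \<open>i < n\<close> by simp
  next
    case (Suc N')
    with pCons.prems have IH: "poly_act S v p $ j = (\<Sum>k<Suc N'. coeff p k * ((*\<^sub>v) S ^^ k) v $ j)"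
      if "j < n" for j
      using pCons.IH that by (auto split: if_splits)
    have "(S *\<^sub>v poly_act S v p) $ i = (\<Sum>j<n. S $$ (i, j) * poly_act S v p $ j)"
      by (rule index_mult_mat_vec_sum[OF S poly_act_carrier \<open>i < n\<close>])
    also have "\<dots> = (\<Sum>j<n. S $$ (i, j) * (\<Sum>k<N. coeff p k * ((*\<^sub>v) S ^^ k) v $ j))"
      using IH Suc by (intro sum.cong) auto
    also have "\<dots> = (\<Sum>k<N. coeff p k * (\<Sum>j<n. S $$ (i, j) * ((*\<^sub>v) S ^^ k) v $ j))"
      by (simp add: sum_distrib_left sum.swap[of _ "{..<n}"] mult_ac)
    also have "\<dots> = (\<Sum>k<N. coeff p k * ((*\<^sub>v) S ^^ Suc k) v $ i)"
      using \<open>i < n\<close> by (simp add: index_mult_mat_vec_sum[OF S Sk])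
    finally show ?thesis .
  qed
  moreover have "(\<Sum>k<Suc N. coeff (pCons a p) k * ((*\<^sub>v) S ^^ k) v $ i)
      = a * v $ i + (\<Sum>k<N. coeff p k * ((*\<^sub>v) S ^^ Suc k) v $ i)"
    by (subst sum.lessThan_Suc_shift) simp
  ultimately show ?case
    using \<open>i < n\<close> v S by (simp add: poly_act_pCons del: funpow.simps)
qed (simp add: \<open>i < n\<close>)

lemma annihilating_poly_exists:
  obtains p where "p \<noteq> 0" "poly_act S v p = 0\<^sub>v n"
proof -
  define K where "K = cols_mat n (Suc n) (\<lambda>k. ((*\<^sub>v) S ^^ k) v)"
  obtain c where c: "c \<in> carrier_vec (Suc n)" "c \<noteq> 0\<^sub>v (Suc n)" "K *\<^sub>v c = 0\<^sub>v n"
    using wide_mat_kernel_nonzero[of K n "Suc n"] by (auto simp: K_def)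
  define p where "p = Poly (list_of_vec c)"
  have coeff_p: "coeff p k = (if k < Suc n then c $ k else 0)" for k
    using c(1) by (auto simp: p_def nth_default_def list_of_vec_index)
  obtain k where "k < Suc n" "c $ k \<noteq> 0"
    using nonzero_vec_index[OF c(1,2)] by blast
  then have "p \<noteq> 0" using coeff_p[of k] by auto
  have "degree p \<le> n" by (rule degree_le) (auto simp: coeff_p)
  have "poly_act S v p = 0\<^sub>v n"
  proof (rule eq_vecI)
    fix i assume "i < dim_vec (0\<^sub>v n :: complex vec)"
    then have i: "i < n" by simp
    have "poly_act S v p $ i = (\<Sum>k<Suc n. K $$ (i, k) * c $ k)"
      using i by (simp add: poly_act_index[OF \<open>degree p \<le> n\<close> i] coeff_p K_def cols_mat_def mult.commute)
    also have "\<dots> = (K *\<^sub>v c) $ i"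
      by (rule index_mult_mat_vec_sum[symmetric]) (use i c(1) in \<open>auto simp: K_def\<close>)
    finally show "poly_act S v p $ i = 0\<^sub>v n $ i" using c(3) i by simp
  qed simp
  with \<open>p \<noteq> 0\<close> show ?thesis using that by blast
qed

end

text \<open>Factor a nonzero polynomial \<open>p\<close> with \<open>p(S) v = 0\<close> into linear factors over \<open>\<complex>\<close>: the
  partial product \<open>q\<close> at which \<open>q(S) v \<noteq> 0\<close> but \<open>(S - r) q(S) v = 0\<close> gives an eigenvector.\<close>
lemma invariant_subspace_has_eigenvector:
  fixes S :: "complex mat"
  assumes S: "S \<in> carrier_mat n n" and W: "subspace_vec n W"
    and inv: "\<And>u. u \<in> W \<Longrightarrow> S *\<^sub>v u \<in> W" and v: "v \<in> W" "v \<noteq> 0\<^sub>v n"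
  obtains u r where "u \<in> W" "eigenvector S u r"
proof -
  have vc: "v \<in> carrier_vec n" using W v by (auto simp: subspace_vec_def)
  have "\<exists>u r. u \<in> W \<and> eigenvector S u r" if "p \<noteq> 0" "poly_act S v p = 0\<^sub>v n" for p
    using that
  proof (induction "degree p" arbitrary: p rule: less_induct)
    case less
    show ?case
    proof (cases "degree p = 0")
      case True
      then obtain a where "p = [:a:]" "a \<noteq> 0" using less.prems by (metis degree_eq_zeroE pCons_0_0)
      then have "a \<cdot>\<^sub>v v = 0\<^sub>v n" using less.prems S vc by (simp add: poly_act_pCons)
      with \<open>a \<noteq> 0\<close> show ?thesis using smult_vec_eq_zero_iff[OF vc v(2)] by simp
    next
      case False
      then have "\<not> constant (poly p)" by (simp add: constant_degree)
      then obtain r where "poly p r = 0" using fundamental_theorem_of_algebra by blast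
      then obtain q where pq: "p = [:-r, 1:] * q" by (metis dvdE poly_eq_0_iff_dvd)
      with less.prems have "q \<noteq> 0" by auto
      have "degree p = degree [:-r, 1:] + degree q"
        unfolding pq by (rule degree_mult_eq) (use \<open>q \<noteq> 0\<close> in auto)
      then have "degree q < degree p" by simp
      show ?thesis
      proof (cases "poly_act S v q = 0\<^sub>v n")
        case True
        with less.hyps[OF \<open>degree q < degree p\<close> \<open>q \<noteq> 0\<close>] show ?thesis by blast
      next
        case False
        let ?u = "poly_act S v q"
        have "S *\<^sub>v ?u - r \<cdot>\<^sub>v ?u = 0\<^sub>v n"
          using less.prems pq poly_act_linear_factor[OF S vc] by simp
        then have "S *\<^sub>v ?u = r \<cdot>\<^sub>v ?u"
          using S vc by (simp add: minus_vec_eq_zero_iff[of _ n])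
        moreover have "?u \<in> W" by (rule poly_act_in_subspace[OF S vc W inv v(1)])
        ultimately show ?thesis using False S vc by (auto simp: eigenvector_def)
      qed
    qed
  qed
  then show ?thesis
    using annihilating_poly_exists[OF S vc] that by blast
qed


lemma finite_eigenvalues:
  fixes A :: "'a :: field mat"
  assumes A: "A \<in> carrier_mat n n"
  shows "finite {k. eigenvalue A k}"
proof -
  have "char_poly A \<noteq> 0" using degree_monic_char_poly[OF A] by (metis coeff_0 zero_neq_one)
  then show ?thesis by (simp add: eigenvalue_root_char_poly[OF A] poly_roots_finite)
qed

lemma mat_poly_carrier: "A \<in> carrier_mat n n \<Longrightarrow> mat_poly n f A \<in> carrier_mat n n"
proof -
  assume A: "A \<in> carrier_mat n n"
  have "foldr (\<lambda>i B. coeff f i \<cdot>\<^sub>m A ^\<^sub>m i + B) is (0\<^sub>m n n) \<in> carrier_mat n n" for "is"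
    using A by (induction "is") auto
  then show ?thesis unfolding mat_poly_def .
qed

lemma smult_mat_mult_vec:
  fixes M :: "'a :: comm_semiring_0 mat"
  assumes "M \<in> carrier_mat n m" "u \<in> carrier_vec m"
  shows "(c \<cdot>\<^sub>m M) *\<^sub>v u = c \<cdot>\<^sub>v (M *\<^sub>v u)"
  using assms by (intro eq_vecI) (auto simp: scalar_prod_def sum_distrib_left mult.assoc)

lemma mat_poly_eigenvector:
  assumes A: "A \<in> carrier_mat n n" and ev: "eigenvector A v \<alpha>"
  shows "mat_poly n f A *\<^sub>v v = poly f \<alpha> \<cdot>\<^sub>v v"
proof -
  have v: "v \<in> carrier_vec n" using ev A by (auto simp: eigenvector_def)
  have "foldr (\<lambda>i B. coeff f i \<cdot>\<^sub>m A ^\<^sub>m i + B) is (0\<^sub>m n n) \<in> carrier_mat n n \<and>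
    foldr (\<lambda>i B. coeff f i \<cdot>\<^sub>m A ^\<^sub>m i + B) is (0\<^sub>m n n) *\<^sub>v v = (\<Sum>i\<leftarrow>is. coeff f i * \<alpha> ^ i) \<cdot>\<^sub>v v"
    for "is"
  proof (induction "is")
    case (Cons i "is")
    let ?B = "foldr (\<lambda>i B. coeff f i \<cdot>\<^sub>m A ^\<^sub>m i + B) is (0\<^sub>m n n)"
    have B: "?B \<in> carrier_mat n n" using Cons by simp
    have "(coeff f i \<cdot>\<^sub>m A ^\<^sub>m i + ?B) *\<^sub>v v = coeff f i \<cdot>\<^sub>v (A ^\<^sub>m i *\<^sub>v v) + ?B *\<^sub>v v"
      using A B v by (simp add: add_mult_distrib_mat_vec[of _ n n] smult_mat_mult_vec[of _ n n])
    also have "\<dots> = (\<Sum>i\<leftarrow>i # is. coeff f i * \<alpha> ^ i) \<cdot>\<^sub>v v"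
      using v Cons eigenvector_pow[OF A ev] by (auto intro!: eq_vecI simp: distrib_right)
    finally show ?case using A B by simp
  qed (use v in \<open>auto intro!: eq_vecI\<close>)
  then have "mat_poly n f A *\<^sub>v v = (\<Sum>i\<leftarrow>[0..<Suc (degree f)]. coeff f i * \<alpha> ^ i) \<cdot>\<^sub>v v"
    unfolding mat_poly_def by blast
  also have "(\<Sum>i\<leftarrow>[0..<Suc (degree f)]. coeff f i * \<alpha> ^ i) = poly f \<alpha>"
    unfolding poly_altdef interv_sum_list_conv_sum_set_nat
    by (simp only: atLeast0LessThan lessThan_Suc_atMost set_upt)
  finally show ?thesis .
qed

lemma mat_diag_mult_vec_index:
  assumes "u \<in> carrier_vec m" "k < m"
  shows "(mat_diag m d *\<^sub>v u) $ k = d k * u $ k"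
proof -
  have "(mat_diag m d *\<^sub>v u) $ k = (\<Sum>j<m. mat_diag m d $$ (k, j) * u $ j)"
    by (rule index_mult_mat_vec_sum) (use assms in auto)
  also have "\<dots> = d k * u $ k"
    using assms(2) by (simp add: mat_diag_def if_distrib[of "\<lambda>x. x * _"] sum.delta cong: if_cong)
  finally show ?thesis .
qed

lemma cols_mat_inj_if_distinct_eigenvalues:
  fixes A :: "complex mat"
  assumes A: "A \<in> carrier_mat n n" and ev: "\<And>k. k < m \<Longrightarrow> eigenvector A (w k) (d k)"
    and d: "inj_on d {..<m}"
    and v: "v \<in> carrier_vec m" "cols_mat n m w *\<^sub>v v = 0\<^sub>v n"
  shows "v = 0\<^sub>v m"
proof (rule ccontr)
  let ?P = "cols_mat n m w" and ?D = "mat_diag m d"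
  let ?K = "{u \<in> carrier_vec m. ?P *\<^sub>v u = 0\<^sub>v n}"
  have w: "\<And>k. k < m \<Longrightarrow> w k \<in> carrier_vec n" and Aw: "\<And>k. k < m \<Longrightarrow> A *\<^sub>v w k = d k \<cdot>\<^sub>v w k"
    and w0: "\<And>k. k < m \<Longrightarrow> w k \<noteq> 0\<^sub>v n"
    using ev A by (auto simp: eigenvector_def)
  have AP: "A * ?P = ?P * ?D"
    using mult_cols_mat_monomial[OF A, of m w d "\<lambda>k. k"] w Aw by (simp add: mat_diag_def)
  have K_inv: "?D *\<^sub>v u \<in> ?K" if "u \<in> ?K" for u
  proof -
    have "?P *\<^sub>v (?D *\<^sub>v u) = (A * ?P) *\<^sub>v u"
      unfolding AP using that by (intro assoc_mult_mat_vec[symmetric]) auto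
    also have "\<dots> = A *\<^sub>v (?P *\<^sub>v u)" using that A by (intro assoc_mult_mat_vec) auto
    also have "\<dots> = 0\<^sub>v n" using that A by simp
    moreover have "?D *\<^sub>v u \<in> carrier_vec m"
      using that by (intro mult_mat_vec_carrier[OF mat_diag_dim]) simp
    ultimately show ?thesis by simp
  qed
  assume v0: "v \<noteq> 0\<^sub>v m"
  have vK: "v \<in> ?K" using v by simp
  obtain u r where "u \<in> ?K" "eigenvector ?D u r"
    by (rule invariant_subspace_has_eigenvector[OF mat_diag_dim
          subspace_vec_kernel_mat[OF cols_mat_carrier] K_inv vK v0])
  then have u: "u \<in> carrier_vec m" "u \<noteq> 0\<^sub>v m" "?P *\<^sub>v u = 0\<^sub>v n" and Du: "?D *\<^sub>v u = r \<cdot>\<^sub>v u"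
    using mat_diag_dim[of m d] by (auto simp: eigenvector_def)
  have du: "d k * u $ k = r * u $ k" if "k < m" for k
    using arg_cong[OF Du, of "\<lambda>x. x $ k"] that u(1) by (simp add: mat_diag_mult_vec_index)
  obtain j where j: "j < m" "u $ j \<noteq> 0"
    using nonzero_vec_index[OF u(1,2)] by blast
  have "u $ k = 0" if "k < m" "k \<noteq> j" for k
  proof (rule ccontr)
    assume "u $ k \<noteq> 0"
    then have "d k = d j" using du[OF that(1)] du[OF j(1)] j(2) by simp
    then show False using d that j by (auto dest: inj_onD)
  qed
  then have "u = u $ j \<cdot>\<^sub>v unit_vec m j"
    using u(1) j by (intro eq_vecI) auto
  then have "?P *\<^sub>v u = u $ j \<cdot>\<^sub>v w j"
    using cols_mat_mult_unit_vec[of j m w n, OF j(1) w[OF j(1)]] mult_mat_vec[of ?P n m "unit_vec m j"]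
    by (metis cols_mat_carrier unit_vec_carrier)
  then have "u $ j \<cdot>\<^sub>v w j = 0\<^sub>v n" using u(3) by simp
  then show False using j smult_vec_eq_zero_iff[OF w[OF j(1)] w0[OF j(1)]] by simp
qed


definition minimal_period :: "('a \<Rightarrow> 'a) \<Rightarrow> 'a \<Rightarrow> nat \<Rightarrow> bool" where
  "minimal_period g x m \<longleftrightarrow> 0 < m \<and> (g ^^ m) x = x \<and> (\<forall>d. 0 < d \<and> d < m \<longrightarrow> (g ^^ d) x \<noteq> x)"

lemma finite_orbit_has_minimal_period:
  assumes "finite (range (\<lambda>k. (g ^^ k) x))"
  obtains p m where "minimal_period g ((g ^^ p) x) m"
proof -
  have "\<not> inj (\<lambda>k. (g ^^ k) x)" using assms finite_imageD infinite_UNIV_nat by blast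
  then obtain p q where "p < q" "(g ^^ p) x = (g ^^ q) x"
    unfolding inj_def by (metis linorder_neq_iff)
  define y where "y = (g ^^ p) x"
  have "(g ^^ (q - p)) y = (g ^^ (q - p + p)) x" by (simp add: y_def funpow_add)
  also have "\<dots> = y" using \<open>p < q\<close> \<open>(g ^^ p) x = (g ^^ q) x\<close> by (simp add: y_def)
  finally have "(g ^^ (q - p)) y = y" .
  define m where "m = (LEAST d. 0 < d \<and> (g ^^ d) y = y)"
  have "0 < m \<and> (g ^^ m) y = y"
    unfolding m_def by (rule LeastI[of _ "q - p"]) (use \<open>p < q\<close> \<open>(g ^^ (q - p)) y = y\<close> in simp)
  moreover have "(g ^^ d) y \<noteq> y" if "0 < d" "d < m" for d
    using not_less_Least[of d "\<lambda>d. 0 < d \<and> (g ^^ d) y = y"] that unfolding m_def by blast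
  ultimately show ?thesis using that[of p m] unfolding minimal_period_def y_def by blast
qed

definition orbit_seq :: "('a \<Rightarrow> 'a) \<Rightarrow> nat \<Rightarrow> 'a \<Rightarrow> int \<Rightarrow> 'a" where
  "orbit_seq g m x i = (g ^^ nat (i mod int m)) x"

context
  fixes g :: "'a \<Rightarrow> 'a" and x :: 'a and m :: nat
  assumes period: "minimal_period g x m"
begin

lemma minimal_period_funpow_mod: "(g ^^ k) x = (g ^^ (k mod m)) x"
proof -
  have "((g ^^ m) ^^ t) x = x" for t
    using period by (induction t) (auto simp: minimal_period_def)
  then have "(g ^^ (r + m * t)) x = (g ^^ r) x" for r t
    by (simp add: funpow_add funpow_mult)
  then show ?thesis by (metis mod_mult_div_eq add.commute)
qed

lemma minimal_period_funpow_inj: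
  assumes "i < m" "j < m" "(g ^^ i) x = (g ^^ j) x"
  shows "i = j"
proof -
  have "(g ^^ (m - j + i)) x = x" if "i < j" "j < m" "(g ^^ i) x = (g ^^ j) x" for i j
  proof -
    have "(g ^^ (m - j + i)) x = (g ^^ (m - j)) ((g ^^ j) x)" by (simp add: funpow_add that(3))
    also have "\<dots> = (g ^^ (m - j + j)) x" by (simp add: funpow_add)
    also have "\<dots> = x" using that period by (simp add: minimal_period_def)
    finally show ?thesis .
  qed
  moreover have "\<not> (g ^^ (m - j + i)) x = x" if "i < j" "j < m" for i j
    using period that unfolding minimal_period_def by auto
  ultimately show ?thesis using assms by (metis linorder_neq_iff)
qed

lemma orbit_seq_of_nat: "orbit_seq g m x (int k) = (g ^^ k) x"
  using minimal_period_funpow_mod[of k] by (simp add: orbit_seq_def flip: of_nat_mod)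

lemma orbit_seq_succ: "orbit_seq g m x (i + 1) = g (orbit_seq g m x i)"
proof -
  define k where "k = nat (i mod int m)"
  have "i mod int m = int k" using period by (simp add: k_def minimal_period_def)
  then have "(i + 1) mod int m = int (Suc k mod m)"
    by (metis mod_add_left_eq of_nat_Suc add.commute of_nat_mod)
  then have "orbit_seq g m x (i + 1) = (g ^^ (Suc k mod m)) x" by (simp add: orbit_seq_def)
  also have "\<dots> = (g ^^ Suc k) x" by (rule minimal_period_funpow_mod[symmetric])
  finally show ?thesis by (simp add: orbit_seq_def k_def)
qed

lemma orbit_seq_periods: "{k. \<forall>i. orbit_seq g m x (i + k) = orbit_seq g m x i} = {j * int m | j. True}"
proof (intro equalityI subsetI)
  fix k assume "k \<in> {k. \<forall>i. orbit_seq g m x (i + k) = orbit_seq g m x i}"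
  then have "orbit_seq g m x k = orbit_seq g m x 0" by (metis (mono_tags) mem_Collect_eq add_0)
  then have "(g ^^ nat (k mod int m)) x = (g ^^ 0) x" by (simp add: orbit_seq_def)
  moreover have "nat (k mod int m) < m" using period by (simp add: minimal_period_def nat_less_iff)
  ultimately have "nat (k mod int m) = 0"
    using minimal_period_funpow_inj[of "nat (k mod int m)" 0] period
    by (simp add: minimal_period_def)
  then have "k mod int m = 0" using period by (simp add: minimal_period_def order.antisym)
  then have "k = (k div int m) * int m" by (metis div_mult_mod_eq add_0_right)
  then show "k \<in> {j * int m | j. True}" by blast
qed (auto simp: orbit_seq_def)

end

lemma seq_order_orbit_seq:
  fixes g :: "complex \<Rightarrow> complex"
  shows "minimal_period g x m \<Longrightarrow> seq_order (orbit_seq g m x) (int m)"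
  by (simp add: seq_order_def orbit_seq_periods)

lemma orbit_seq_in_S_f: "minimal_period (poly f) x m \<Longrightarrow> orbit_seq (poly f) m x \<in> S_f f"
  by (simp add: S_f_def orbit_seq_succ)


lemma B'_X_carrier: "B'_X m lam z a \<in> carrier_mat m m"
  and B'_Y_carrier: "B'_Y m a \<in> carrier_mat m m"
  and B'_H_carrier: "B'_H m lam \<in> carrier_mat m m"
  by (simp_all add: B'_X_def B'_Y_def B'_H_def)

lemma unit_vec_nonzero: "k < m \<Longrightarrow> unit_vec m k \<noteq> (0\<^sub>v m :: 'a :: zero_neq_one vec)"
  by (metis index_unit_vec(1) index_zero_vec(1) zero_neq_one)

lemma B'_X_mult_unit_vec:
  assumes "k < m"
  shows "B'_X m lam z a *\<^sub>v unit_vec m k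
    = ((lam (int k + 1) + z) * (if k + 1 = m then a else 1)) \<cdot>\<^sub>v unit_vec m ((k + 1) mod m)"
proof (rule eq_vecI)
  fix i assume "i < dim_vec (((lam (int k + 1) + z) * (if k + 1 = m then a else 1)) \<cdot>\<^sub>v unit_vec m ((k + 1) mod m))"
  then have i: "i < m" by simp
  have "(B'_X m lam z a *\<^sub>v unit_vec m k) $ i = (\<Sum>j<m. B'_X m lam z a $$ (i, j) * unit_vec m k $ j)"
    by (rule index_mult_mat_vec_sum[OF B'_X_carrier]) (use i in auto)
  also have "\<dots> = B'_X m lam z a $$ (i, k)"
    using assms by (simp add: if_distrib[of "\<lambda>x. _ * x"] sum.delta' cong: if_cong)
  finally show "(B'_X m lam z a *\<^sub>v unit_vec m k) $ i
      = (((lam (int k + 1) + z) * (if k + 1 = m then a else 1)) \<cdot>\<^sub>v unit_vec m ((k + 1) mod m)) $ i"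
    using i assms by (simp add: B'_X_def unit_vec_def)
qed (simp add: B'_X_def)

lemma B'_X_nilpotent_has_zero_weight:
  assumes m: "0 < m" and a: "a \<noteq> 0" and nil: "B'_X m lam z a ^\<^sub>m m = 0\<^sub>m m m"
  shows "\<exists>i. lam i + z = 0"
proof (rule ccontr)
  assume no_zero: "\<nexists>i. lam i + z = 0"
  let ?B = "B'_X m lam z a"
  have step: "\<exists>t. t \<noteq> 0 \<and> ((*\<^sub>v) ?B ^^ j) (unit_vec m 0) = t \<cdot>\<^sub>v unit_vec m (j mod m)" for j
  proof (induction j)
    case (Suc j)
    then obtain t where t: "t \<noteq> 0" "((*\<^sub>v) ?B ^^ j) (unit_vec m 0) = t \<cdot>\<^sub>v unit_vec m (j mod m)"
      by blast
    let ?s = "(lam (int (j mod m) + 1) + z) * (if j mod m + 1 = m then a else 1)"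
    have "?s \<noteq> 0" using no_zero a by auto
    have "((*\<^sub>v) ?B ^^ Suc j) (unit_vec m 0) = t \<cdot>\<^sub>v (?B *\<^sub>v unit_vec m (j mod m))"
      using t(2) mult_mat_vec[OF B'_X_carrier] by simp
    also have "\<dots> = (t * ?s) \<cdot>\<^sub>v unit_vec m (Suc j mod m)"
      using m by (simp add: B'_X_mult_unit_vec mod_Suc_eq smult_smult_assoc)
    finally show ?case using t(1) \<open>?s \<noteq> 0\<close> by (intro exI[of _ "t * ?s"]) simp
  qed (auto intro!: exI[of _ 1])
  then obtain t where t: "t \<noteq> 0" "((*\<^sub>v) ?B ^^ m) (unit_vec m 0) = t \<cdot>\<^sub>v unit_vec m 0"
    by (metis mod_self)
  have "((*\<^sub>v) ?B ^^ m) (unit_vec m 0) = ?B ^\<^sub>m m *\<^sub>v unit_vec m 0"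
    by (rule pow_mat_mult_vec[symmetric, OF B'_X_carrier unit_vec_carrier])
  also have "\<dots> = 0\<^sub>v m" unfolding nil by (intro eq_vecI) auto
  finally have "((*\<^sub>v) ?B ^^ m) (unit_vec m 0) = 0\<^sub>v m" .
  then show False
    using t by (simp add: smult_vec_eq_zero_iff[OF unit_vec_carrier unit_vec_nonzero[OF m]])
qed


locale simple_Hf_rep =
  fixes f :: "complex poly" and n :: nat and X Y H :: "complex mat"
  assumes simple: "simple_Hf_module f n X Y H"
begin

abbreviation F :: "complex mat" where "F \<equiv> mat_poly n f H"

lemma X_carrier: "X \<in> carrier_mat n n" and Y_carrier: "Y \<in> carrier_mat n n"
  and H_carrier: "H \<in> carrier_mat n n" and F_carrier: "F \<in> carrier_mat n n"
  and n_pos: "0 < n"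
  using simple mat_poly_carrier by (auto simp: simple_Hf_module_def Hf_module_def)

lemma dim_mats [simp]:
  "dim_row X = n" "dim_col X = n" "dim_row Y = n" "dim_col Y = n"
  "dim_row H = n" "dim_col H = n" "dim_row F = n" "dim_col F = n"
  using X_carrier Y_carrier H_carrier F_carrier by auto

lemma mult_vec_carrier [simp]:
  "u \<in> carrier_vec n \<Longrightarrow> X *\<^sub>v u \<in> carrier_vec n"
  "u \<in> carrier_vec n \<Longrightarrow> Y *\<^sub>v u \<in> carrier_vec n"
  "u \<in> carrier_vec n \<Longrightarrow> H *\<^sub>v u \<in> carrier_vec n"
  "u \<in> carrier_vec n \<Longrightarrow> F *\<^sub>v u \<in> carrier_vec n"
  using X_carrier Y_carrier H_carrier F_carrier by auto

lemma H_X_vec: "u \<in> carrier_vec n \<Longrightarrow> H *\<^sub>v (X *\<^sub>v u) = X *\<^sub>v (F *\<^sub>v u)"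
  using simple X_carrier H_carrier F_carrier
  by (auto simp: simple_Hf_module_def Hf_module_def assoc_mult_mat_vec[symmetric, of _ n n _ n]
      simp del: assoc_mult_mat_vec)

lemma Y_H_vec: "u \<in> carrier_vec n \<Longrightarrow> Y *\<^sub>v (H *\<^sub>v u) = F *\<^sub>v (Y *\<^sub>v u)"
  using simple Y_carrier H_carrier F_carrier
  by (auto simp: simple_Hf_module_def Hf_module_def assoc_mult_mat_vec[symmetric, of _ n n _ n]
      simp del: assoc_mult_mat_vec)

lemma Y_X_vec: "u \<in> carrier_vec n \<Longrightarrow> Y *\<^sub>v (X *\<^sub>v u) = X *\<^sub>v (Y *\<^sub>v u) + (F *\<^sub>v u - H *\<^sub>v u)"
proof -
  assume u: "u \<in> carrier_vec n"
  have "(Y * X - X * Y) *\<^sub>v u = (F - H) *\<^sub>v u"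
    using simple by (simp add: simple_Hf_module_def Hf_module_def)
  then have "Y *\<^sub>v (X *\<^sub>v u) - X *\<^sub>v (Y *\<^sub>v u) = F *\<^sub>v u - H *\<^sub>v u"
    using u X_carrier Y_carrier H_carrier F_carrier by (simp add: minus_mult_distrib_mat_vec[of _ n n])
  then show ?thesis using u by (simp add: minus_vec_eq_iff_eq_add[of _ n])
qed

lemma submodule_eq_carrier:
  assumes "subspace_vec n W" and "\<And>u. u \<in> W \<Longrightarrow> X *\<^sub>v u \<in> W \<and> Y *\<^sub>v u \<in> W \<and> H *\<^sub>v u \<in> W"
    and "u \<in> W" "u \<noteq> 0\<^sub>v n"
  shows "W = carrier_vec n"
  using simple assms unfolding simple_Hf_module_def by blast

lemma commuting_mat_is_scalar:
  assumes C: "C \<in> carrier_mat n n"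
    and comm: "\<And>u. u \<in> carrier_vec n \<Longrightarrow>
      C *\<^sub>v (X *\<^sub>v u) = X *\<^sub>v (C *\<^sub>v u) \<and> C *\<^sub>v (Y *\<^sub>v u) = Y *\<^sub>v (C *\<^sub>v u) \<and> C *\<^sub>v (H *\<^sub>v u) = H *\<^sub>v (C *\<^sub>v u)"
  obtains c where "\<And>u. u \<in> carrier_vec n \<Longrightarrow> C *\<^sub>v u = c \<cdot>\<^sub>v u"
proof -
  obtain u c where "u \<in> carrier_vec n" "eigenvector C u c"
    by (rule invariant_subspace_has_eigenvector[OF C subspace_vec_carrier_vec _
          unit_vec_carrier unit_vec_nonzero[OF n_pos]]) (use C in auto)
  let ?E = "{v \<in> carrier_vec n. C *\<^sub>v v = c \<cdot>\<^sub>v v}"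
  have "?E = carrier_vec n"
  proof (rule submodule_eq_carrier[OF subspace_vec_eigenspace[OF C]])
    fix v assume "v \<in> ?E"
    then show "X *\<^sub>v v \<in> ?E \<and> Y *\<^sub>v v \<in> ?E \<and> H *\<^sub>v v \<in> ?E"
      using comm X_carrier Y_carrier H_carrier by (auto simp: mult_mat_vec)
  next
    show "u \<in> ?E" "u \<noteq> 0\<^sub>v n" using \<open>eigenvector C u c\<close> C by (auto simp: eigenvector_def)
  qed
  then show thesis using that by blast
qed

text \<open>Schur's lemma applied to the Casimir element \<open>xy - h\<close>, which is central in \<open>\<H>(f)\<close>.\<close>
lemma casimir_scalar:
  obtains c where "\<And>u. u \<in> carrier_vec n \<Longrightarrow> X *\<^sub>v (Y *\<^sub>v u) = H *\<^sub>v u + c \<cdot>\<^sub>v u"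
proof -
  define C where "C = X * Y - H"
  have C: "C \<in> carrier_mat n n" unfolding C_def by (rule minus_carrier_mat[OF H_carrier])
  have Cu: "C *\<^sub>v u = X *\<^sub>v (Y *\<^sub>v u) - H *\<^sub>v u" if "u \<in> carrier_vec n" for u
    using that X_carrier Y_carrier H_carrier by (simp add: C_def minus_mult_distrib_mat_vec[of _ n n])
  note distrib = mult_add_distrib_mat_vec[OF X_carrier] mult_minus_distrib_mat_vec[OF X_carrier]
    mult_minus_distrib_mat_vec[OF Y_carrier] mult_minus_distrib_mat_vec[OF H_carrier]
  have "C *\<^sub>v (X *\<^sub>v u) = X *\<^sub>v (C *\<^sub>v u)" if u: "u \<in> carrier_vec n" for u
  proof -
    have "C *\<^sub>v (X *\<^sub>v u) = X *\<^sub>v (X *\<^sub>v (Y *\<^sub>v u) + (F *\<^sub>v u - H *\<^sub>v u)) - X *\<^sub>v (F *\<^sub>v u)"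
      using u by (simp add: Cu Y_X_vec H_X_vec)
    also have "\<dots> = X *\<^sub>v (C *\<^sub>v u)"
      using u by (simp add: Cu distrib) (auto intro!: eq_vecI)
    finally show ?thesis .
  qed
  moreover have "C *\<^sub>v (Y *\<^sub>v u) = Y *\<^sub>v (C *\<^sub>v u)" if u: "u \<in> carrier_vec n" for u
  proof -
    have "Y *\<^sub>v (C *\<^sub>v u) = X *\<^sub>v (Y *\<^sub>v (Y *\<^sub>v u)) + (F *\<^sub>v (Y *\<^sub>v u) - H *\<^sub>v (Y *\<^sub>v u)) - F *\<^sub>v (Y *\<^sub>v u)"
      using u by (simp add: Cu distrib Y_X_vec Y_H_vec)
    also have "\<dots> = C *\<^sub>v (Y *\<^sub>v u)"
      using u by (simp add: Cu) (auto intro!: eq_vecI)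
    finally show ?thesis by simp
  qed
  moreover have "C *\<^sub>v (H *\<^sub>v u) = H *\<^sub>v (C *\<^sub>v u)" if u: "u \<in> carrier_vec n" for u
    using u by (simp add: Cu distrib Y_H_vec H_X_vec)
  ultimately obtain c where "\<And>u. u \<in> carrier_vec n \<Longrightarrow> C *\<^sub>v u = c \<cdot>\<^sub>v u"
    using commuting_mat_is_scalar[OF C] by blast
  then show thesis
    using that Cu by (simp add: minus_vec_eq_iff_eq_add[of _ n])
qed

end


locale simple_Hf_rep_inv = simple_Hf_rep +
  fixes T :: "complex mat"
  assumes T_carrier: "T \<in> carrier_mat n n" and Y_T: "Y * T = 1\<^sub>m n" and T_Y: "T * Y = 1\<^sub>m n"
begin

lemma T_vec_carrier [simp]: "u \<in> carrier_vec n \<Longrightarrow> T *\<^sub>v u \<in> carrier_vec n"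
  using T_carrier by simp

lemma Y_T_vec: "u \<in> carrier_vec n \<Longrightarrow> Y *\<^sub>v (T *\<^sub>v u) = u"
  using Y_T T_carrier Y_carrier by (simp add: assoc_mult_mat_vec[symmetric, of _ n n _ n] del: assoc_mult_mat_vec)

lemma T_Y_vec: "u \<in> carrier_vec n \<Longrightarrow> T *\<^sub>v (Y *\<^sub>v u) = u"
  using T_Y T_carrier Y_carrier by (simp add: assoc_mult_mat_vec[symmetric, of _ n n _ n] del: assoc_mult_mat_vec)

lemma T_funpow_carrier [simp]: "u \<in> carrier_vec n \<Longrightarrow> ((*\<^sub>v) T ^^ k) u \<in> carrier_vec n"
  by (induction k) auto

lemma T_funpow_nonzero:
  assumes "u \<in> carrier_vec n" "u \<noteq> 0\<^sub>v n"
  shows "((*\<^sub>v) T ^^ k) u \<noteq> 0\<^sub>v n"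
proof (induction k)
  case (Suc k)
  let ?w = "((*\<^sub>v) T ^^ k) u"
  have "?w = Y *\<^sub>v (T *\<^sub>v ?w)" using assms by (simp add: Y_T_vec)
  with Suc show ?case using Y_carrier by auto
qed (use assms in simp)

lemma X_eq_casimir_T:
  assumes casimir: "\<And>u. u \<in> carrier_vec n \<Longrightarrow> X *\<^sub>v (Y *\<^sub>v u) = H *\<^sub>v u + c \<cdot>\<^sub>v u"
    and u: "u \<in> carrier_vec n"
  shows "X *\<^sub>v u = H *\<^sub>v (T *\<^sub>v u) + c \<cdot>\<^sub>v (T *\<^sub>v u)"
  using casimir[of "T *\<^sub>v u"] u by (simp add: Y_T_vec)

text \<open>The relation \<open>yh = f(h)y\<close> makes \<open>T = y\<^sup>-\<^sup>1\<close> shift weights from \<open>\<alpha>\<close> to \<open>f(\<alpha>)\<close>.\<close>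
lemma T_eigenvector:
  assumes ev: "eigenvector H u \<alpha>"
  shows "eigenvector H (T *\<^sub>v u) (poly f \<alpha>)"
proof -
  have u: "u \<in> carrier_vec n" "u \<noteq> 0\<^sub>v n" using ev by (auto simp: eigenvector_def)
  have "Y *\<^sub>v (H *\<^sub>v (T *\<^sub>v u)) = poly f \<alpha> \<cdot>\<^sub>v u"
    using u by (simp add: Y_H_vec Y_T_vec mat_poly_eigenvector[OF H_carrier ev])
  then have "H *\<^sub>v (T *\<^sub>v u) = T *\<^sub>v (poly f \<alpha> \<cdot>\<^sub>v u)"
    using u T_Y_vec[of "H *\<^sub>v (T *\<^sub>v u)"] by simp
  then show ?thesis
    using u T_funpow_nonzero[of u 1] by (simp add: eigenvector_def mult_mat_vec[OF T_carrier])
qed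

lemma T_funpow_eigenvector:
  "eigenvector H u \<alpha> \<Longrightarrow> eigenvector H (((*\<^sub>v) T ^^ k) u) ((poly f ^^ k) \<alpha>)"
  by (induction k) (auto intro: T_eigenvector)

text \<open>Since \<open>H\<close> has finitely many eigenvalues, some weight \<open>\<nu>\<close> is periodic under \<open>f\<close>, and
  \<open>T\<^sup>m\<close> preserves the \<open>\<nu>\<close>-weight space, where it has an eigenvector.\<close>
lemma periodic_weight_vector:
  obtains \<nu> m v a where "minimal_period (poly f) \<nu> m" "eigenvector H v \<nu>" "a \<noteq> 0"
    "((*\<^sub>v) T ^^ m) v = a \<cdot>\<^sub>v v"
proof -
  obtain v0 \<mu> where "v0 \<in> carrier_vec n" "eigenvector H v0 \<mu>"
    by (rule invariant_subspace_has_eigenvector[OF H_carrier subspace_vec_carrier_vec _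
          unit_vec_carrier unit_vec_nonzero[OF n_pos]]) simp
  then have "range (\<lambda>k. (poly f ^^ k) \<mu>) \<subseteq> {\<alpha>. eigenvalue H \<alpha>}"
    using T_funpow_eigenvector by (auto simp: eigenvalue_def)
  then have "finite (range (\<lambda>k. (poly f ^^ k) \<mu>))"
    using finite_eigenvalues[OF H_carrier] by (rule finite_subset)
  then obtain p m where period: "minimal_period (poly f) ((poly f ^^ p) \<mu>) m"
    by (rule finite_orbit_has_minimal_period)
  define \<nu> where "\<nu> = (poly f ^^ p) \<mu>"
  let ?E = "{u \<in> carrier_vec n. H *\<^sub>v u = \<nu> \<cdot>\<^sub>v u}"
  have Tm: "T ^\<^sub>m m *\<^sub>v u = ((*\<^sub>v) T ^^ m) u" if "u \<in> carrier_vec n" for u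
    by (rule pow_mat_mult_vec[OF T_carrier that])
  have "T ^\<^sub>m m *\<^sub>v u \<in> ?E" if u: "u \<in> ?E" for u
  proof (cases "u = 0\<^sub>v n")
    case True
    then show ?thesis using pow_carrier_mat[OF T_carrier, of m] H_carrier by simp (rule eq_vecI; simp)
  next
    case False
    with u have "eigenvector H u \<nu>" by (simp add: eigenvector_def)
    then have "eigenvector H (((*\<^sub>v) T ^^ m) u) ((poly f ^^ m) \<nu>)" by (rule T_funpow_eigenvector)
    then have "eigenvector H (((*\<^sub>v) T ^^ m) u) \<nu>"
      using period by (simp add: minimal_period_def \<nu>_def)
    then show ?thesis using u by (simp add: Tm eigenvector_def)
  qed
  moreover have "eigenvector H (((*\<^sub>v) T ^^ p) v0) \<nu>"
    unfolding \<nu>_def by (rule T_funpow_eigenvector[OF \<open>eigenvector H v0 \<mu>\<close>])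
  then have "((*\<^sub>v) T ^^ p) v0 \<in> ?E" "((*\<^sub>v) T ^^ p) v0 \<noteq> 0\<^sub>v n"
    by (simp_all add: eigenvector_def)
  ultimately obtain v a where v: "v \<in> ?E" "eigenvector (T ^\<^sub>m m) v a"
    by (rule invariant_subspace_has_eigenvector[OF pow_carrier_mat[OF T_carrier] subspace_vec_eigenspace[OF H_carrier]])
  have vc: "v \<in> carrier_vec n" "v \<noteq> 0\<^sub>v n" "T ^\<^sub>m m *\<^sub>v v = a \<cdot>\<^sub>v v"
    using v(2) T_carrier by (simp_all add: eigenvector_def)
  then have Tmv: "((*\<^sub>v) T ^^ m) v = a \<cdot>\<^sub>v v" by (simp add: Tm)
  have "minimal_period (poly f) \<nu> m" using period by (simp add: \<nu>_def)
  moreover have "eigenvector H v \<nu>" using v(1) vc by (simp add: eigenvector_def)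
  moreover have "a \<noteq> 0"
  proof
    assume "a = 0"
    then have "((*\<^sub>v) T ^^ m) v = 0\<^sub>v n" using Tmv vc(1) by simp (rule eq_vecI; simp)
    then show False using T_funpow_nonzero[OF vc(1,2)] by blast
  qed
  ultimately show thesis using Tmv by (rule that)
qed

end


locale Hf_weight_cycle = simple_Hf_rep_inv +
  fixes c \<nu> :: complex and m :: nat and v :: "complex vec" and a :: complex
  assumes casimir: "\<And>u. u \<in> carrier_vec n \<Longrightarrow> X *\<^sub>v (Y *\<^sub>v u) = H *\<^sub>v u + c \<cdot>\<^sub>v u"
    and period: "minimal_period (poly f) \<nu> m"
    and weight: "eigenvector H v \<nu>"
    and a_nonzero: "a \<noteq> 0"
    and cycle: "((*\<^sub>v) T ^^ m) v = a \<cdot>\<^sub>v v"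
begin

text \<open>The vectors \<open>w k = T\<^sup>k v\<close> play the role of the basis \<open>t\<^sup>k\<close> of \<open>B'(\<lambda>, c, a)\<close>.\<close>
definition w :: "nat \<Rightarrow> complex vec" where "w k = ((*\<^sub>v) T ^^ k) v"

abbreviation lam :: "int \<Rightarrow> complex" where "lam \<equiv> orbit_seq (poly f) m \<nu>"

abbreviation P :: "complex mat" where "P \<equiv> cols_mat n m w"

lemma m_pos: "0 < m"
  using period by (simp add: minimal_period_def)

lemma w_carrier [simp]: "w k \<in> carrier_vec n"
  using weight by (simp add: w_def eigenvector_def)

lemma w_eigenvector: "eigenvector H (w k) (lam (int k))"
  using T_funpow_eigenvector[OF weight] by (simp add: w_def orbit_seq_of_nat[OF period])

lemma T_w: "T *\<^sub>v w k = w (Suc k)"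
  by (simp add: w_def)

lemma w_m: "w m = a \<cdot>\<^sub>v w 0"
  by (simp add: w_def cycle)

lemma Y_w:
  assumes "k < m"
  shows "Y *\<^sub>v w k = (if k = 0 then inverse a else 1) \<cdot>\<^sub>v w ((k + m - 1) mod m)"
proof (cases k)
  case 0
  have "w 0 = inverse a \<cdot>\<^sub>v w m" using a_nonzero by (simp add: w_m smult_smult_assoc)
  also have "\<dots> = inverse a \<cdot>\<^sub>v (T *\<^sub>v w (m - 1))" using m_pos by (simp add: T_w)
  finally have "Y *\<^sub>v w 0 = inverse a \<cdot>\<^sub>v w (m - 1)"
    by (simp add: mult_mat_vec[OF Y_carrier] Y_T_vec)
  then show ?thesis using 0 m_pos by simp
next
  case (Suc k')
  then have "(k + m - 1) mod m = k'" using assms by simp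
  then show ?thesis using Suc by (simp add: Y_T_vec flip: T_w)
qed

lemma X_w:
  assumes "k < m"
  shows "X *\<^sub>v w k = ((lam (int k + 1) + c) * (if k + 1 = m then a else 1)) \<cdot>\<^sub>v w ((k + 1) mod m)"
proof -
  have "X *\<^sub>v w k = (lam (int k + 1) + c) \<cdot>\<^sub>v w (Suc k)"
    using w_eigenvector[of "Suc k"] X_eq_casimir_T[OF casimir, of "w k"]
    by (simp add: T_w eigenvector_def add_smult_distrib_vec add.commute[of 1 "int k"])
  then show ?thesis using assms by (cases "k + 1 = m") (simp_all add: w_m smult_smult_assoc)
qed

lemma H_P: "H * P = P * B'_H m lam"
  using mult_cols_mat_monomial[OF H_carrier, of m w "\<lambda>k. lam (int k)" "\<lambda>k. k"] w_eigenvector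
  by (simp add: eigenvector_def B'_H_def)

lemma Y_P: "Y * P = P * B'_Y m a"
  using mult_cols_mat_monomial[OF Y_carrier, of m w "\<lambda>k. if k = 0 then inverse a else 1" "\<lambda>k. (k + m - 1) mod m"]
    Y_w m_pos by (simp add: B'_Y_def)

lemma X_P: "X * P = P * B'_X m lam c a"
  using mult_cols_mat_monomial[OF X_carrier, of m w
      "\<lambda>k. (lam (int k + 1) + c) * (if k + 1 = m then a else 1)" "\<lambda>k. (k + 1) mod m"]
    X_w m_pos by (simp add: B'_X_def)

lemma P_surj:
  assumes "u \<in> carrier_vec n"
  shows "\<exists>x \<in> carrier_vec m. P *\<^sub>v x = u"
proof -
  let ?W = "{P *\<^sub>v x | x. x \<in> carrier_vec m}"
  have "w 0 = P *\<^sub>v unit_vec m 0" by (rule cols_mat_mult_unit_vec[symmetric, OF m_pos w_carrier])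
  then have "w 0 \<in> ?W" using unit_vec_carrier[of m 0] by blast
  then have "?W = carrier_vec n"
    using w_eigenvector[of 0] subspace_vec_range_mat[OF cols_mat_carrier]
      intertwine_range_invariant[OF X_carrier cols_mat_carrier B'_X_carrier X_P]
      intertwine_range_invariant[OF Y_carrier cols_mat_carrier B'_Y_carrier Y_P]
      intertwine_range_invariant[OF H_carrier cols_mat_carrier B'_H_carrier H_P]
    by (intro submodule_eq_carrier[of ?W "w 0"]) (auto simp: eigenvector_def)
  then have "u \<in> ?W" using assms by simp
  then show ?thesis by blast
qed

lemma P_inj: "x \<in> carrier_vec m \<Longrightarrow> P *\<^sub>v x = 0\<^sub>v n \<Longrightarrow> x = 0\<^sub>v m"
proof (rule cols_mat_inj_if_distinct_eigenvalues[OF H_carrier w_eigenvector])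
  show "inj_on (\<lambda>k. lam (int k)) {..<m}"
    using minimal_period_funpow_inj[OF period] by (auto simp: inj_on_def orbit_seq_of_nat[OF period])
qed

lemma m_eq_n: "m = n"
  and P_invertible: "\<exists>Q \<in> carrier_mat n n. P * Q = 1\<^sub>m n \<and> Q * P = 1\<^sub>m n"
  using square_mat_of_inj_surj[OF cols_mat_carrier P_inj P_surj] by blast+

end


theorem lemma10:
  fixes f :: "complex poly" and n :: nat and X Y H :: "complex mat"
  assumes "simple_Hf_module f n X Y H"
    and "{Y *\<^sub>v v | v. v \<in> carrier_vec n} = carrier_vec n"
    and "X ^\<^sub>m n = 0\<^sub>m n n"
  shows "\<exists>z a lam. a \<noteq> 0 \<and> lam \<in> S_f f \<and> seq_order lam (int n) \<and>
           (\<exists>i. lam i + z = 0) \<and>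
           Hf_iso n X Y H (B'_X n lam z a) (B'_Y n a) (B'_H n lam)"
proof -
  interpret simple_Hf_rep f n X Y H by unfold_locales (rule assms(1))
  have "\<exists>v \<in> carrier_vec n. Y *\<^sub>v v = u" if "u \<in> carrier_vec n" for u
  proof -
    have "u \<in> {Y *\<^sub>v v | v. v \<in> carrier_vec n}" using assms(2) that by simp
    then show ?thesis by blast
  qed
  then obtain T where T: "T \<in> carrier_mat n n" "Y * T = 1\<^sub>m n"
    by (rule surj_mat_right_inverse[OF Y_carrier])
  interpret simple_Hf_rep_inv f n X Y H T
    using T mat_mult_left_right_inverse[OF Y_carrier T] by unfold_locales auto
  obtain c where casimir: "\<And>u. u \<in> carrier_vec n \<Longrightarrow> X *\<^sub>v (Y *\<^sub>v u) = H *\<^sub>v u + c \<cdot>\<^sub>v u"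
    using casimir_scalar by blast
  obtain \<nu> m v a where "minimal_period (poly f) \<nu> m" "eigenvector H v \<nu>" "a \<noteq> 0"
    "((*\<^sub>v) T ^^ m) v = a \<cdot>\<^sub>v v"
    by (rule periodic_weight_vector)
  then interpret Hf_weight_cycle f n X Y H T c \<nu> m v a
    using casimir by unfold_locales
  obtain Q where Q: "Q \<in> carrier_mat n n" "P * Q = 1\<^sub>m n" "Q * P = 1\<^sub>m n"
    using P_invertible by blast
  have P: "P \<in> carrier_mat n n" by (simp add: m_eq_n)
  have XP: "X * P = P * B'_X n lam c a" and YP: "Y * P = P * B'_Y n a" and HP: "H * P = P * B'_H n lam"
    using X_P Y_P H_P by (simp_all add: m_eq_n)
  have "B'_X n lam c a ^\<^sub>m n = 0\<^sub>m n n"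
    by (rule intertwine_nilpotent[OF X_carrier B'_X_carrier P Q(1,3) XP assms(3)])
  then have "\<exists>i. lam i + c = 0" by (rule B'_X_nilpotent_has_zero_weight[OF n_pos a_nonzero])
  moreover have "Hf_iso n X Y H (B'_X n lam c a) (B'_Y n a) (B'_H n lam)"
    unfolding Hf_iso_def
    using Q intertwine_inverse_mat[OF P Q(1) X_carrier B'_X_carrier Q(2,3) XP]
      intertwine_inverse_mat[OF P Q(1) Y_carrier B'_Y_carrier Q(2,3) YP]
      intertwine_inverse_mat[OF P Q(1) H_carrier B'_H_carrier Q(2,3) HP] P by blast
  ultimately show ?thesis
    using a_nonzero orbit_seq_in_S_f[OF period] seq_order_orbit_seq[OF period] m_eq_n by blast
qed

end
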